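(* Under full information feedback, the OGD-CB algorithm $\beta$ guarantees \[\liminf_{T\to\infty,\ B=\rho T}\ \inf_{\bm v,\,G}\ \frac1T\,\mathbb E_{\bm p\sim G^T}\Big[R^\beta(\bm v,\bm p)-\frac{\rho}{\bar v}\,R^{\mathrm H}(\bm v,\bm p)\Big]\ \ge 0,\] where the infimum is over value sequences $\bm v\in[0,\bar v]^T$ and distributions $G$ on $[0,\bar v]$.
   Context: Model: constants $\bar v>0$, $\rho\in(0,\bar v]$; $T$ rounds; budget $B=\rho T$. Round $t$: value $v_t\in[0,\bar v]$ (an arbitrary, adversarial sequence); highest competing bid $p_t$ i.i.d. from an unknown distribution $G$ on $[0,\bar v]$. Buyer chooses $x_t\in\{0,1\}$, receives $x_tr_t$ with $r_t=(v_t-p_t)^+$, pays $x_tc_t$ with $c_t=p_t\mathbf 1[v_t\ge p_t]$. Full information: $p_t$ observed at the end of every round. Revenue $R^\beta(\bm v,\bm p)=\sum_{t=1}^{T_0}x_tr_t$, $T_0$ the ending time. Hindsight benchmark: $R^{\mathrm H}(\bm v,\bm p)=\max_{\bm x\in\{0,1\}^T}\sum_tx_t(v_t-p_t)^+$ s.t. $\sum_tx_tp_t\mathbf 1[v_t\ge p_t]\le T\rho$. OGD-CB algorithm: $\mathcal I_1=\emptyset$, $B_1=B$, $\lambda_1=0$. For $t=1,\dots,T$: observe $v_t$. If $t=1$: $x_1=1$, $\lambda_2=\lambda_1$. Otherwise: $\epsilon_t=\sqrt{(\ln 2+2\ln T)/(2|\mathcal I_t|)}$; $\tilde r_t(v)=\frac1{|\mathcal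 I_t|}\sum_{\tau\in\mathcal I_t}(v-p_\tau)^++\epsilon_tv$; $\tilde c_t(v)=\frac1{|\mathcal I_t|}\sum_{\tau\in\mathcal I_t}p_\tau\mathbf 1[v\ge p_\tau]-2\epsilon_tv$; $x_t=\mathbf 1[\tilde r_t(v_t)\ge\lambda_t\tilde c_t(v_t)]$; $\eta_t=1/(\bar v\sqrt t)$; $\lambda_{t+1}=(\lambda_t+\eta_t(x_t\tilde c_t(v_t)-\rho))^+$. Observe $p_t$ and set $\mathcal I_{t+1}=\mathcal I_t\cup\{t\}$. Set $B_{t+1}=B_t-x_tc_t$; if $B_{t+1}<\bar v$, stop; $T_0$ is the stopping round (or $T$). *)

theory Defs
  imports "HOL-Probability.Probability"
begin

text \<open>Rounds are indexed 1..T. v, p :: nat => real (only values on 1..T matter).\<close>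

definition rew :: "real \<Rightarrow> real \<Rightarrow> real" where
  "rew vt pt = max (vt - pt) 0"

definition cst :: "real \<Rightarrow> real \<Rightarrow> real" where
  "cst vt pt = pt * (if vt \<ge> pt then 1 else 0)"

text \<open>Empirical optimistic estimates used in round t (t >= 2), with I_t = {1..<t}.\<close>

definition eps_t :: "nat \<Rightarrow> nat \<Rightarrow> real" where
  "eps_t T t = sqrt ((ln 2 + 2 * ln (real T)) / (2 * real (card {1..<t})))"

definition rtil :: "nat \<Rightarrow> (nat \<Rightarrow> real) \<Rightarrow> nat \<Rightarrow> real \<Rightarrow> real" where
  "rtil T p t x = (1 / real (card {1..<t})) * (\<Sum>\<tau>\<in>{1..<t}. max (x - p \<tau>) 0) + eps_t T t * x"

definition ctil :: "nat \<Rightarrow> (nat \<Rightarrow> real) \<Rightarrow> nat \<Rightarrow> real \<Rightarrow> real" where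
  "ctil T p t x = (1 / real (card {1..<t})) * (\<Sum>\<tau>\<in>{1..<t}. p \<tau> * (if x \<ge> p \<tau> then 1 else 0))
                   - 2 * eps_t T t * x"

definition ogd_x :: "nat \<Rightarrow> (nat \<Rightarrow> real) \<Rightarrow> (nat \<Rightarrow> real) \<Rightarrow> nat \<Rightarrow> real \<Rightarrow> real" where
  "ogd_x T v p t lam =
     (if t = 1 then 1 else if rtil T p t (v t) \<ge> lam * ctil T p t (v t) then 1 else 0)"

text \<open>State before round t+1 (after n = t rounds):
  (lambda, remaining budget, still running, accumulated revenue).
  ogd_state ... 0 is the initial state (lambda_1 = 0, B_1 = rho T).\<close>

fun ogd_state :: "real \<Rightarrow> real \<Rightarrow> nat \<Rightarrow> (nat \<Rightarrow> real) \<Rightarrow> (nat \<Rightarrow> real) \<Rightarrow> nat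
                   \<Rightarrow> real \<times> real \<times> bool \<times> real" where
  "ogd_state vbar rho T v p 0 = (0, rho * real T, True, 0)"
| "ogd_state vbar rho T v p (Suc n) =
     (let (lam, Bud, run, rv) = ogd_state vbar rho T v p n;
          t = Suc n
      in if \<not> run then (lam, Bud, run, rv)
         else
           (let x = ogd_x T v p t lam;
                lam' = (if t = 1 then lam
                        else max 0 (lam + (1 / (vbar * sqrt (real t))) * (x * ctil T p t (v t) - rho)));
                Bud' = Bud - x * cst (v t) (p t);
                rv' = rv + x * rew (v t) (p t)
            in (lam', Bud', Bud' \<ge> vbar, rv')))"

definition ogd_revenue :: "real \<Rightarrow> real \<Rightarrow> nat \<Rightarrow> (nat \<Rightarrow> real) \<Rightarrow> (nat \<Rightarrow> real) \<Rightarrow> real" where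
  "ogd_revenue vbar rho T v p = snd (snd (snd (ogd_state vbar rho T v p T)))"

text \<open>Hindsight benchmark; a binary vector x is identified with the set S = {t. x_t = 1}.\<close>

definition hindsight :: "real \<Rightarrow> nat \<Rightarrow> (nat \<Rightarrow> real) \<Rightarrow> (nat \<Rightarrow> real) \<Rightarrow> real" where
  "hindsight rho T v p =
     Max ((\<lambda>S. \<Sum>t\<in>S. rew (v t) (p t)) ` {S. S \<subseteq> {1..T} \<and> (\<Sum>t\<in>S. cst (v t) (p t)) \<le> real T * rho})"

definition bid_dists :: "real \<Rightarrow> real measure set" where
  "bid_dists vbar = {G. prob_space G \<and> sets G = sets borel \<and> measure G {0..vbar} = 1}"

definition value_seqs :: "real \<Rightarrow> nat \<Rightarrow> (nat \<Rightarrow> real) set" where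
  "value_seqs vbar T = {v. \<forall>t\<in>{1..T}. v t \<in> {0..vbar}}"

end

theory Submission
  imports Defs "HOL-Real_Asymp.Real_Asymp"
begin

text \<open>
  Put \<open>a = rho / vbar\<close> and let \<open>r t\<close>, \<open>c t\<close> be the expected reward and cost of buying in
  round \<open>t\<close>. The bidding rule maximises \<open>x * (rtil - lam * ctil)\<close>; comparing it with the
  fractional choice \<open>x = a\<close> and using \<open>a * ctil \<le> rho\<close> gives
  \<open>x * r t \<ge> a * r t + lam * (x * ctil - rho)\<close> up to twice the error of \<open>rtil\<close>. The regret bound of
  projected gradient descent (whose iterates stay bounded) replaces \<open>lam\<close> by any fixed \<open>l\<close> in
  \<open>[0, 1]\<close> at cost \<open>O(sqrt T * ln T)\<close>. If the algorithm never stops, take \<open>l = 0\<close>. If it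
  stops after \<open>T0\<close> rounds, its budget is spent, so \<open>l = 1\<close> yields an extra \<open>rho * (T - T0)\<close>, which
  pays for \<open>a\<close> times the reward of the remaining rounds. Hence the revenue is at least \<open>a\<close> times the
  total reward of all rounds, which dominates the hindsight optimum, up to error terms.

  Since \<open>v\<close> is fixed in advance, every error term is an average or martingale of the form
  \<open>\<Sum>t. y t * (h t (p t) - E (h t))\<close> with \<open>y t\<close> depending only on past prices, so orthogonality of
  increments bounds its expected absolute value by \<open>K * sqrt n\<close>.
\<close>

section \<open>Martingale sums\<close>

text \<open>Predictability of \<open>y\<close> is phrased as invariance under overwriting
  coordinates \<open>s \<ge> t\<close>, which replaces a filtration. The weighted centred increments
  are then orthogonal in L2, so the second moment of \<open>S n\<close> is at most
  \<open>n * K^2\<close>, and the L1 bound follows.\<close>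

lemma abs_sum_predictable_expectation:
  fixes G :: "'a measure" and y :: "nat \<Rightarrow> (nat \<Rightarrow> 'a) \<Rightarrow> real" and h :: "nat \<Rightarrow> 'a \<Rightarrow> real"
  assumes G: "prob_space G" and I: "finite I" "{1..n} \<subseteq> I" and K: "0 < K"
    and y_meas: "\<And>t. t \<in> {1..n} \<Longrightarrow> y t \<in> borel_measurable (PiM I (\<lambda>_. G))"
    and y_bound: "\<And>t p. \<bar>y t p\<bar> \<le> 1"
    and y_past: "\<And>t s p u. t \<le> s \<Longrightarrow> y t (p(s := u)) = y t p"
    and h_meas: "\<And>t. t \<in> {1..n} \<Longrightarrow> h t \<in> borel_measurable G"
    and h_bound: "\<And>t u. 0 \<le> h t u \<and> h t u \<le> K"
  defines "S \<equiv> \<lambda>m p. \<Sum>t=1..m. y t p * (h t (p t) - (\<integral>u. h t u \<partial>G))"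
  shows "integrable (PiM I (\<lambda>_. G)) (\<lambda>p. \<bar>S n p\<bar>)" (is ?int)
    and "(\<integral>p. \<bar>S n p\<bar> \<partial>(PiM I (\<lambda>_. G))) \<le> K * sqrt (real n)" (is ?le)
proof -
  interpret G: prob_space G by (rule G)
  interpret PG: product_prob_space "\<lambda>_. G" I
    by (simp add: product_prob_space_def product_sigma_finite_def product_prob_space_axioms_def
        G G.sigma_finite_measure_axioms)
  let ?M = "PiM I (\<lambda>_. G)"
  define D where "D t u = h t u - (\<integral>u. h t u \<partial>G)" for t u
  have h_int: "integrable G (h t)" if "t \<in> {1..n}" for t
    using h_bound[of t] h_meas[OF that] by (intro G.integrable_const_bound[where B=K]) auto
  have D_int: "integrable G (D t)" "(\<integral>u. D t u \<partial>G) = 0" if "t \<in> {1..n}" for t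
    unfolding D_def using h_int[OF that] by (auto simp: G.prob_space)
  have mean: "0 \<le> (\<integral>u. h t u \<partial>G)" "(\<integral>u. h t u \<partial>G) \<le> K" if "t \<in> {1..n}" for t
    using h_bound[of t] h_int[OF that]
    by (auto intro!: integral_nonneg G.integral_le_const)
  have D_bound: "\<bar>D t u\<bar> \<le> K" if "t \<in> {1..n}" for t u
    using mean[OF that] h_bound[of t u] by (auto simp: D_def)
  have D_meas: "(\<lambda>p. D t (p t)) \<in> borel_measurable ?M" if "t \<in> {1..n}" for t
  proof -
    have "t \<in> I" using that I by auto
    then have "(\<lambda>p. p t) \<in> measurable ?M G" by (rule measurable_component_singleton)
    moreover have "D t \<in> borel_measurable G" unfolding D_def using h_meas[OF that] by auto
    ultimately show ?thesis by (rule measurable_compose)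
  qed
  have S_eq: "S m p = (\<Sum>t=1..m. y t p * D t (p t))" for m p
    by (simp add: S_def D_def)
  have S_meas: "S m \<in> borel_measurable ?M" if "m \<le> n" for m
  proof -
    have "(\<lambda>p. \<Sum>t=1..m. y t p * D t (p t)) \<in> borel_measurable ?M"
      using that by (intro borel_measurable_sum borel_measurable_times y_meas D_meas) auto
    then show ?thesis by (simp add: S_eq[abs_def])
  qed
  have S_bound: "\<bar>S m p\<bar> \<le> real m * K" if "m \<le> n" for m p
  proof -
    have "\<bar>S m p\<bar> \<le> (\<Sum>t=1..m. \<bar>y t p * D t (p t)\<bar>)" unfolding S_eq by (rule sum_abs)
    also have "\<dots> \<le> (\<Sum>t=1..m. 1 * K)"
      unfolding abs_mult using that
      by (intro sum_mono mult_mono y_bound D_bound) auto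
    finally show ?thesis by simp
  qed
  have S_past: "S m (p(s := u)) = S m p" if "m < s" for m s p u
    unfolding S_eq using that by (intro sum.cong) (auto simp: y_past)
  \<comment> \<open>Fubini with coordinate \<open>t\<close> innermost: \<open>F\<close> does not see
    that coordinate and \<open>D t\<close> has mean zero.\<close>
  have cross: "(\<integral>p. F p * D t (p t) \<partial>?M) = 0"
    if t: "t \<in> {1..n}" and F: "F \<in> borel_measurable ?M" "\<And>p. \<bar>F p\<bar> \<le> C"
      and past: "\<And>p u. F (p(t := u)) = F p" for F :: "(nat \<Rightarrow> 'a) \<Rightarrow> real" and C t
  proof -
    have ins: "I = insert t (I - {t})" using t I by auto
    have "integrable ?M (\<lambda>p. F p * D t (p t))"
      using F D_meas[OF t] D_bound[OF t] K
      by (intro PG.integrable_const_bound[where B="C * K"])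
        (auto simp: abs_mult intro!: AE_I2 mult_mono intro: order_trans[OF abs_ge_zero])
    then have "(\<integral>p. F p * D t (p t) \<partial>?M)
       = (\<integral>p. \<integral>u. F (p(t := u)) * D t ((p(t := u)) t) \<partial>G \<partial>(PiM (I - {t}) (\<lambda>_. G)))"
      using PG.product_integral_insert[of "I - {t}" t "\<lambda>p. F p * D t (p t)"] I ins by simp
    also have "\<dots> = 0" using D_int[OF t] by (simp add: past)
    finally show ?thesis .
  qed
  have second_moment: "integrable ?M (\<lambda>p. (S m p)\<^sup>2) \<and> (\<integral>p. (S m p)\<^sup>2 \<partial>?M) \<le> real m * K\<^sup>2"
    if "m \<le> n" for m
    using that
  proof (induction m)
    case 0
    then show ?case by (simp add: S_def)
  next
    case (Suc m)
    let ?t = "Suc m"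
    have t: "?t \<in> {1..n}" using Suc by auto
    have "m \<le> n" using Suc by simp
    note IH = Suc.IH[OF this] and Sm = S_meas[OF this] and Sb = S_bound[OF this]
    have F_meas: "(\<lambda>p. S m p * y ?t p) \<in> borel_measurable ?M"
      using Sm y_meas[OF t] by simp
    have F_bound: "\<bar>S m p * y ?t p\<bar> \<le> (real m * K) * 1" for p
      unfolding abs_mult by (intro mult_mono Sb y_bound) (use K in auto)
    have cr: "(\<integral>p. S m p * y ?t p * D ?t (p ?t) \<partial>?M) = 0"
      by (rule cross[OF t F_meas F_bound]) (simp add: S_past y_past)
    have cr_int: "integrable ?M (\<lambda>p. S m p * y ?t p * D ?t (p ?t))"
    proof (rule PG.integrable_const_bound[where B="(real m * K) * 1 * K"])
      show "AE p in ?M. norm (S m p * y ?t p * D ?t (p ?t)) \<le> (real m * K) * 1 * K"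
        unfolding real_norm_def abs_mult[of "_ * _" "D _ _"]
        by (intro AE_I2 mult_mono F_bound D_bound t) (use K in auto)
    qed (use F_meas D_meas[OF t] in simp)
    have sq_le: "(y ?t p * D ?t (p ?t))\<^sup>2 \<le> K\<^sup>2" for p
    proof -
      have "\<bar>y ?t p * D ?t (p ?t)\<bar> \<le> 1 * K"
        unfolding abs_mult by (intro mult_mono y_bound D_bound t) auto
      then show ?thesis using K by (intro abs_le_square_iff[THEN iffD1]) auto
    qed
    have sq_int: "integrable ?M (\<lambda>p. (y ?t p * D ?t (p ?t))\<^sup>2)"
      using sq_le y_meas[OF t] D_meas[OF t]
      by (intro PG.integrable_const_bound[where B="K\<^sup>2"]) auto
    have sq_E: "(\<integral>p. (y ?t p * D ?t (p ?t))\<^sup>2 \<partial>?M) \<le> K\<^sup>2"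
      using sq_le by (intro PG.integral_le_const sq_int) auto
    have expand: "(S ?t p)\<^sup>2 = (S m p)\<^sup>2 + 2 * (S m p * y ?t p * D ?t (p ?t))
        + (y ?t p * D ?t (p ?t))\<^sup>2" for p
      unfolding S_eq by (simp add: power2_sum algebra_simps)
    show ?case
      unfolding expand using IH cr cr_int sq_int sq_E
      by (auto simp: Bochner_Integration.integral_add algebra_simps)
  qed
  show ?int
    using S_meas[of n] S_bound[of n] by (intro PG.integrable_const_bound[where B="real n * K"]) auto
  show ?le
  proof (cases "n = 0")
    case True
    then show ?thesis by (simp add: S_def)
  next
    case False
    \<comment> \<open>\<open>c\<close> bounds the L2 norm of \<open>S n\<close>, so the two halves
      of \<open>amgm\<close> balance; this stands in for Cauchy-Schwarz. Division by
      \<open>c\<close> is why \<open>n = 0\<close> is treated apart.\<close>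
    define c where "c = K * sqrt (real n)"
    have c: "c > 0" "real n * K\<^sup>2 = c\<^sup>2" using False K by (auto simp: c_def power_mult_distrib)
    have amgm: "\<bar>z\<bar> \<le> (z\<^sup>2 / c + c) / 2" for z :: real
    proof -
      have "0 \<le> (\<bar>z\<bar> - c)\<^sup>2" by simp
      then show ?thesis using c by (simp add: field_simps power2_diff power2_eq_square)
    qed
    have sm: "integrable ?M (\<lambda>p. (S n p)\<^sup>2)" "(\<integral>p. (S n p)\<^sup>2 \<partial>?M) \<le> c\<^sup>2"
      using second_moment[of n] c by auto
    have "(\<integral>p. \<bar>S n p\<bar> \<partial>?M) \<le> (\<integral>p. ((S n p)\<^sup>2 / c + c) / 2 \<partial>?M)"
      using sm by (intro integral_mono \<open>?int\<close> amgm) auto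
    also have "\<dots> = ((\<integral>p. (S n p)\<^sup>2 \<partial>?M) / c + c) / 2"
      using sm PG.P.prob_space by simp
    also have "\<dots> \<le> (c\<^sup>2 / c + c) / 2"
      using sm c by (intro divide_right_mono add_right_mono) auto
    also have "\<dots> = c" using c by (simp add: power2_eq_square)
    finally show ?thesis by (simp add: c_def)
  qed
qed

section \<open>Elementary estimates\<close>

text \<open>With \<open>a\<close>, \<open>b\<close> the two roots,
  \<open>(a - b) * (a + b) = 1\<close> and \<open>a + b \<le> 2 * a\<close>. The right side
  telescopes, both in the next sum and in the induction of \<open>ogd_regret\<close>.\<close>

lemma inverse_sqrt_le: "1 / sqrt (real (Suc n)) \<le> 2 * (sqrt (real (Suc n)) - sqrt (real n))"
proof -
  define a b where "a = sqrt (real (Suc n))" and "b = sqrt (real n)"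
  have ab: "0 \<le> b" "b \<le> a" "0 < a" "a\<^sup>2 - b\<^sup>2 = 1" by (auto simp: a_def b_def)
  have "1 = (a - b) * (a + b)" using ab by (simp add: algebra_simps power2_eq_square)
  also have "\<dots> \<le> (a - b) * (2 * a)" using ab by (intro mult_left_mono) auto
  finally have "1 / a \<le> 2 * (a - b)" using ab by (simp add: field_simps)
  then show ?thesis unfolding a_def b_def .
qed

lemma sum_inverse_sqrt_le: "(\<Sum>t=2..n. 1 / sqrt (real (t - 1))) \<le> 2 * sqrt (real n)"
proof -
  have "(\<Sum>t=2..Suc m. 1 / sqrt (real (t - 1))) \<le> 2 * sqrt (real m)" for m
  proof (induction m)
    case (Suc m)
    have "(\<Sum>t=2..Suc (Suc m). 1 / sqrt (real (t - 1)))
        = (\<Sum>t=2..Suc m. 1 / sqrt (real (t - 1))) + 1 / sqrt (real (Suc m))"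
      by (subst sum.atLeast_Suc_atMost_Suc_shift[symmetric, of _ 1, simplified] | simp)+
    then show ?case using Suc inverse_sqrt_le[of m] by simp
  qed simp
  note this[of "n - 1"]
  also have "2 * sqrt (real (n - 1)) \<le> 2 * sqrt (real n)" by simp
  finally show ?thesis by (cases n) auto
qed

lemma mult_le_abs:
  fixes y z :: real
  assumes "0 \<le> y" "y \<le> 1" shows "y * z \<le> \<bar>z\<bar>"
proof -
  have "y * z \<le> y * \<bar>z\<bar>" using assms by (intro mult_left_mono) auto
  also have "\<dots> \<le> 1 * \<bar>z\<bar>" using assms by (intro mult_right_mono) auto
  finally show ?thesis by simp
qed

text \<open>For \<open>t \<le> 1\<close> the range is empty and the average is 0 by the convention
  \<open>1 / 0 = 0\<close>; \<open>0 \<le> x\<close> covers this case.\<close>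

lemma average_bounds:
  fixes f :: "nat \<Rightarrow> real"
  assumes "\<And>s. s \<in> {1..<t} \<Longrightarrow> 0 \<le> f s \<and> f s \<le> x" and "0 \<le> x"
  shows "0 \<le> 1 / real (card {1..<t}) * (\<Sum>s\<in>{1..<t}. f s)"
    and "1 / real (card {1..<t}) * (\<Sum>s\<in>{1..<t}. f s) \<le> x"
proof -
  show "0 \<le> 1 / real (card {1..<t}) * (\<Sum>s\<in>{1..<t}. f s)"
    using assms by (intro mult_nonneg_nonneg sum_nonneg) auto
  have "(\<Sum>s\<in>{1..<t}. f s) \<le> real (card {1..<t}) * x"
    using assms by (intro sum_bounded_above) auto
  then show "1 / real (card {1..<t}) * (\<Sum>s\<in>{1..<t}. f s) \<le> x"
    using assms(2) by (cases "card {1..<t} = 0") (auto simp: field_simps)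
qed

lemma rew_bounds: "0 \<le> x \<Longrightarrow> 0 \<le> u \<Longrightarrow> 0 \<le> rew x u \<and> rew x u \<le> x"
  by (auto simp: rew_def)

lemma cst_bounds: "0 \<le> x \<Longrightarrow> 0 \<le> u \<Longrightarrow> 0 \<le> cst x u \<and> cst x u \<le> x"
  by (auto simp: cst_def)

lemma rtil_eq: "rtil T p t x = 1 / real (card {1..<t}) * (\<Sum>s\<in>{1..<t}. rew x (p s)) + eps_t T t * x"
  by (simp add: rtil_def rew_def)

lemma ctil_eq: "ctil T p t x = 1 / real (card {1..<t}) * (\<Sum>s\<in>{1..<t}. cst x (p s)) - 2 * eps_t T t * x"
  by (simp add: ctil_def cst_def)

lemma ln_nat_nonneg: "0 \<le> ln (real n)"
  by (cases n) auto

lemma eps_t_nonneg: "0 \<le> eps_t T t"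
  using ln_nat_nonneg[of T] by (simp add: eps_t_def)

lemma eps_t_le: "2 \<le> t \<Longrightarrow> eps_t T t \<le> sqrt (ln 2 + 2 * ln (real T)) * (1 / sqrt (real (t - 1)))"
  using ln_nat_nonneg[of T]
  by (auto simp: eps_t_def real_sqrt_divide[symmetric] intro!: divide_left_mono)

text \<open>Relaxation that drops the budget constraint: rewards are nonnegative, so no set of
  rounds earns more than all rounds together. The empty set is feasible, so the maximum is over a
  nonempty set.\<close>

lemma hindsight_le:
  assumes "0 \<le> rho" shows "hindsight rho T v p \<le> (\<Sum>t=1..T. rew (v t) (p t))"
  unfolding hindsight_def
proof (rule Max.boundedI)
  let ?A = "{S. S \<subseteq> {1..T} \<and> (\<Sum>t\<in>S. cst (v t) (p t)) \<le> real T * rho}"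
  have "finite ?A" by (rule finite_subset[of _ "Pow {1..T}"]) auto
  then show "finite ((\<lambda>S. \<Sum>t\<in>S. rew (v t) (p t)) ` ?A)" by simp
  have "{} \<in> ?A" using assms by simp
  then show "(\<lambda>S. \<Sum>t\<in>S. rew (v t) (p t)) ` ?A \<noteq> {}" by blast
next
  fix a assume "a \<in> (\<lambda>S. \<Sum>t\<in>S. rew (v t) (p t)) `
    {S. S \<subseteq> {1..T} \<and> (\<Sum>t\<in>S. cst (v t) (p t)) \<le> real T * rho}"
  then show "a \<le> (\<Sum>t=1..T. rew (v t) (p t))"
    by (auto intro!: sum_mono2 simp: rew_def)
qed

section \<open>Pathwise analysis\<close>

locale ogd_cb =
  fixes vbar rho :: real and T :: nat and v :: "nat \<Rightarrow> real"
  assumes vbar: "0 < vbar" and rho: "0 < rho" "rho \<le> vbar"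
    and v_range: "t \<in> {1..T} \<Longrightarrow> 0 \<le> v t \<and> v t \<le> vbar"
begin

text \<open>The index counts completed rounds, so the multiplier in force in round \<open>t\<close>
  is \<open>lam p (t - 1)\<close>; the other state components are shifted likewise.\<close>

definition lam :: "(nat \<Rightarrow> real) \<Rightarrow> nat \<Rightarrow> real" where
  "lam p n = fst (ogd_state vbar rho T v p n)"

definition budget :: "(nat \<Rightarrow> real) \<Rightarrow> nat \<Rightarrow> real" where
  "budget p n = fst (snd (ogd_state vbar rho T v p n))"

definition running :: "(nat \<Rightarrow> real) \<Rightarrow> nat \<Rightarrow> bool" where
  "running p n = fst (snd (snd (ogd_state vbar rho T v p n)))"

definition revenue :: "(nat \<Rightarrow> real) \<Rightarrow> nat \<Rightarrow> real" where
  "revenue p n = snd (snd (snd (ogd_state vbar rho T v p n)))"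

text \<open>Masking the decision by \<open>running\<close> makes it 0 after the stop, so sums can
  run over \<open>1..T\<close> with no explicit stopping time.\<close>

definition play :: "nat \<Rightarrow> (nat \<Rightarrow> real) \<Rightarrow> real" where
  "play t p = (if running p (t - 1) then ogd_x T v p t (lam p (t - 1)) else 0)"

definition gradient :: "(nat \<Rightarrow> real) \<Rightarrow> nat \<Rightarrow> real" where
  "gradient p t = play t p * ctil T p t (v t) - rho"

lemma state_0 [simp]:
  "lam p 0 = 0" "budget p 0 = rho * real T" "running p 0" "revenue p 0 = 0"
  by (simp_all add: lam_def budget_def running_def revenue_def)

lemma state_Suc:
  "lam p (Suc n) = (if running p n \<and> n \<noteq> 0
     then max 0 (lam p n + 1 / (vbar * sqrt (real (Suc n))) * gradient p (Suc n)) else lam p n)"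
  "budget p (Suc n) = budget p n - play (Suc n) p * cst (v (Suc n)) (p (Suc n))"
  "running p (Suc n) \<longleftrightarrow> running p n \<and> vbar \<le> budget p (Suc n)"
  "revenue p (Suc n) = revenue p n + play (Suc n) p * rew (v (Suc n)) (p (Suc n))"
  by (auto simp: lam_def budget_def running_def revenue_def play_def gradient_def Let_def
      split: prod.splits)

lemma play_cases: "play t p = 0 \<or> play t p = 1"
  by (simp add: play_def ogd_x_def)

lemma play_bounds: "0 \<le> play t p" "play t p \<le> 1"
  using play_cases[of t p] by auto

lemma ogd_revenue_eq: "ogd_revenue vbar rho T v p = (\<Sum>t=1..T. play t p * rew (v t) (p t))"
proof -
  have "revenue p n = (\<Sum>t=1..n. play t p * rew (v t) (p t))" for n
    by (induction n) (simp_all add: state_Suc)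
  then show ?thesis by (simp add: ogd_revenue_def revenue_def)
qed

lemma budget_eq: "budget p n = rho * real T - (\<Sum>t=1..n. play t p * cst (v t) (p t))"
  by (induction n) (simp_all add: state_Suc)

lemma running_antimono: "m \<le> n \<Longrightarrow> running p n \<Longrightarrow> running p m"
  by (induction rule: dec_induct) (auto simp: state_Suc)

text \<open>Either the last round triggered the stop, or the budget was below \<open>vbar\<close>
  already and nonnegative costs keep it there.\<close>

lemma not_running_budget:
  assumes "\<not> running p n" and nn: "\<And>t. t \<in> {1..n} \<Longrightarrow> 0 \<le> cst (v t) (p t)"
  shows "budget p n < vbar"
  using assms
proof (induction n)
  case (Suc n)
  then show ?case
    using play_bounds(1)[of "Suc n" p] mult_nonneg_nonneg[of "play (Suc n) p" "cst (v (Suc n)) (p (Suc n))"]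
    by (cases "running p n") (fastforce simp: state_Suc)+
qed simp

text \<open>The first summand is a level above which the multiplier cannot increase; the
  \<open>+ 1\<close> covers one last step, since a step adds at most
  \<open>vbar / (vbar * sqrt t) \<le> 1\<close>.\<close>

definition lam_max :: real where "lam_max = 3 * vbar / (2 * rho) + 1"

lemma lam_max_ge: "1 \<le> lam_max"
  using vbar rho by (simp add: lam_max_def)

text \<open>Upper bound for \<open>1 + (eps_t T t)^2\<close>, uniform in
  \<open>t \<ge> 2\<close>.\<close>

definition err_const :: real where "err_const = 1 + ln 2 + 2 * ln (real T)"

section \<open>Bounds along a single path of nonnegative prices\<close>

context
  fixes p :: "nat \<Rightarrow> real"
  assumes p_range: "t \<in> {1..T} \<Longrightarrow> 0 \<le> p t"
begin

text \<open>A purchase happens only at a price up to the value, so reward and cost both lie in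
  \<open>[0, v t]\<close>, and so do their empirical averages.\<close>

lemma estimate_bounds:
  assumes t: "t \<in> {1..T}"
  shows "rtil T p t (v t) \<le> (1 + eps_t T t) * v t"
    "- 2 * eps_t T t * v t \<le> ctil T p t (v t)" "ctil T p t (v t) \<le> (1 - 2 * eps_t T t) * v t"
proof -
  have vt: "0 \<le> v t" using v_range[OF t] by simp
  have pos: "0 \<le> p s" if "s \<in> {1..<t}" for s using that t p_range by auto
  have r: "0 \<le> rew (v t) (p s) \<and> rew (v t) (p s) \<le> v t"
    and c: "0 \<le> cst (v t) (p s) \<and> cst (v t) (p s) \<le> v t" if "s \<in> {1..<t}" for s
    using rew_bounds[OF vt pos[OF that]] cst_bounds[OF vt pos[OF that]] by auto
  note ra = average_bounds[of t "\<lambda>s. rew (v t) (p s)", OF r vt]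
    and ca = average_bounds[of t "\<lambda>s. cst (v t) (p s)", OF c vt]
  have "0 \<le> eps_t T t * v t" using vt eps_t_nonneg by simp
  then show "rtil T p t (v t) \<le> (1 + eps_t T t) * v t"
    "- 2 * eps_t T t * v t \<le> ctil T p t (v t)" "ctil T p t (v t) \<le> (1 - 2 * eps_t T t) * v t"
    using ra ca unfolding rtil_eq ctil_eq by (auto simp: algebra_simps)
qed

lemma ctil_le:
  assumes t: "t \<in> {1..T}" shows "ctil T p t (v t) \<le> vbar"
proof -
  have "0 \<le> eps_t T t * v t" using v_range[OF t] eps_t_nonneg by simp
  then show ?thesis using estimate_bounds(3)[OF t] v_range[OF t] by (simp add: algebra_simps)
qed

lemma lam_nonneg: "0 \<le> lam p n"
  by (induction n) (auto simp: state_Suc)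

text \<open>If \<open>lam\<close> increases in round \<open>t\<close>, then \<open>ctil > rho\<close>, which forces
  \<open>eps_t < 1/2\<close>, and the bidding rule gives \<open>lam * rho \<le> rtil \<le> 3/2 * vbar\<close>.\<close>

lemma lam_le: "n \<le> T \<Longrightarrow> lam p n \<le> lam_max"
proof (induction n)
  case 0
  then show ?case using vbar rho by (simp add: lam_max_def)
next
  case (Suc n)
  let ?t = "Suc n" and ?g = "gradient p (Suc n)" and ?c = "ctil T p (Suc n) (v (Suc n))"
  let ?eta = "1 / (vbar * sqrt (real (Suc n)))"
  have t: "?t \<in> {1..T}" and IH: "lam p n \<le> lam_max" using Suc by auto
  have eta: "0 \<le> ?eta" "?eta * vbar \<le> 1" using vbar by (auto simp: divide_simps)
  show ?case
  proof (cases "running p n \<and> n \<noteq> 0 \<and> 0 < ?g")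
    case False
    then have "?eta * ?g \<le> 0 \<or> \<not> (running p n \<and> n \<noteq> 0)"
      using eta mult_nonneg_nonpos[of ?eta ?g] by (auto simp: not_less)
    then show ?thesis using IH lam_nonneg[of n] by (auto simp: state_Suc)
  next
    case True
    then have x: "play ?t p = 1" using play_cases[of ?t p] rho by (auto simp: gradient_def)
    then have bid: "lam p n * ?c \<le> rtil T p ?t (v ?t)" and c: "rho < ?c"
      using True by (auto simp: play_def ogd_x_def gradient_def split: if_splits)
    have vt: "0 \<le> v ?t" "v ?t \<le> vbar" using v_range[OF t] by auto
    have "0 < (1 - 2 * eps_t T ?t) * v ?t" using estimate_bounds(3)[OF t] c rho by linarith
    then have "eps_t T ?t < 1 / 2" using vt by (auto simp: zero_less_mult_iff)
    then have "(1 + eps_t T ?t) * v ?t \<le> 3 / 2 * vbar"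
      using vt eps_t_nonneg[of T ?t] by (intro mult_mono) auto
    moreover have "lam p n * rho \<le> lam p n * ?c" using c lam_nonneg by (intro mult_left_mono) auto
    ultimately have "lam p n * rho \<le> 3 / 2 * vbar" using bid estimate_bounds(1)[OF t] by linarith
    then have "lam p n \<le> 3 * vbar / (2 * rho)" using rho by (simp add: field_simps)
    moreover have "?eta * ?g \<le> ?eta * vbar"
      using eta x ctil_le[OF t] rho by (intro mult_left_mono) (auto simp: gradient_def)
    ultimately have "lam p n + ?eta * ?g \<le> lam_max" using eta unfolding lam_max_def by linarith
    then show ?thesis using lam_nonneg[of n] IH by (simp add: state_Suc)
  qed
qed

text \<open>The confidence width can exceed 1 in early rounds, so the optimistic cost may be very
  negative; this is the source of the logarithm in \<open>err_const\<close>. The factor 8 comes from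
  \<open>\<bar>gradient\<bar> \<le> 2 * vbar * (1 + eps)\<close> and
  \<open>(1 + eps)^2 \<le> 2 * (1 + eps^2)\<close>.\<close>

lemma gradient_sq_le:
  assumes t: "t \<in> {2..T}"
  shows "(gradient p t)\<^sup>2 \<le> 8 * vbar\<^sup>2 * err_const"
proof -
  have t1: "t \<in> {1..T}" using t by auto
  let ?e = "eps_t T t"
  have e: "0 \<le> ?e" "?e\<^sup>2 \<le> ln 2 + 2 * ln (real T)"
  proof -
    have "(ln 2 + 2 * ln (real T)) / (2 * real (card {1..<t})) \<le> (ln 2 + 2 * ln (real T)) / 1"
      using t ln_nat_nonneg[of T] by (intro divide_left_mono) auto
    then show "?e\<^sup>2 \<le> ln 2 + 2 * ln (real T)"
      using ln_nat_nonneg[of T] by (simp add: eps_t_def)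
  qed (rule eps_t_nonneg)
  have "?e * v t \<le> ?e * vbar" using e v_range[OF t1] by (intro mult_left_mono) auto
  moreover have "0 \<le> ?e * vbar" using e vbar by simp
  ultimately have "\<bar>ctil T p t (v t)\<bar> \<le> vbar + 2 * (?e * vbar)"
    using estimate_bounds(2)[OF t1] ctil_le[OF t1] vbar by (simp add: abs_le_iff)
  then have "\<bar>gradient p t\<bar> \<le> 2 * vbar * (1 + ?e)"
    using play_cases[of t p] rho vbar mult_nonneg_nonneg[OF e(1), of vbar]
    by (auto simp: gradient_def algebra_simps abs_le_iff)
  then have "\<bar>gradient p t\<bar>\<^sup>2 \<le> (2 * vbar * (1 + ?e))\<^sup>2" by (intro power_mono) auto
  also have "\<dots> = vbar\<^sup>2 * (4 * (1 + ?e)\<^sup>2)" by (simp add: power2_eq_square algebra_simps)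
  also have "\<dots> \<le> vbar\<^sup>2 * (8 * err_const)"
  proof (intro mult_left_mono)
    have "0 \<le> (1 - ?e)\<^sup>2" by simp
    then have "(1 + ?e)\<^sup>2 \<le> 2 * (1 + ?e\<^sup>2)" by (simp add: power2_eq_square algebra_simps)
    then have "4 * (1 + ?e)\<^sup>2 \<le> 8 * (1 + ?e\<^sup>2)" by simp
    also have "\<dots> \<le> 8 * err_const" using e by (simp add: err_const_def)
    finally show "4 * (1 + ?e)\<^sup>2 \<le> 8 * err_const" .
  qed simp
  finally show ?thesis by (simp add: mult_ac)
qed

text \<open>Regret of projected gradient steps against a fixed \<open>l\<close>. The induction keeps
  the term \<open>- (lam p n - l)^2\<close>, which does the work of summation by parts for
  decreasing step sizes. Stopped rounds contribute 0 and leave the multiplier unchanged.\<close>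

lemma ogd_regret:
  assumes l: "0 \<le> l" "l \<le> 1" and n: "1 \<le> n" "n \<le> T"
  shows "(\<Sum>t=2..n. of_bool (running p (t - 1)) * ((l - lam p (t - 1)) * gradient p t))
    \<le> sqrt (real n) * (vbar / 2 * (lam_max\<^sup>2 - (lam p n - l)\<^sup>2) + 8 * vbar * err_const)"
  using n
proof (induction n rule: nat_induct_at_least)
  case base
  have "l \<le> lam_max" using l lam_max_ge by simp
  then have "l\<^sup>2 \<le> lam_max\<^sup>2" using l by (intro power_mono)
  then show ?case using vbar ln_nat_nonneg[of T]
    by (auto simp: state_Suc err_const_def intro!: add_nonneg_nonneg)
next
  case (Suc n)
  let ?t = "Suc n" and ?W = "\<lambda>m. vbar / 2 * (lam_max\<^sup>2 - (lam p m - l)\<^sup>2)"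
  have t: "?t \<in> {2..T}" using Suc by auto
  have K: "0 \<le> 8 * vbar * err_const" using vbar ln_nat_nonneg[of T] by (simp add: err_const_def)
  have "\<bar>lam p n - l\<bar> \<le> \<bar>lam_max\<bar>"
    using lam_nonneg[of n] lam_le[of n] l Suc.prems lam_max_ge by (simp add: abs_le_iff)
  then have "(lam p n - l)\<^sup>2 \<le> lam_max\<^sup>2" by (simp add: abs_le_square_iff)
  \<comment> \<open>The potential is nonnegative, so raising its weight from \<open>sqrt n\<close>
    to \<open>sqrt (Suc n)\<close> only weakens the bound.\<close>
  then have W: "sqrt (real n) * ?W n \<le> sqrt (real ?t) * ?W n"
    using vbar by (intro mult_right_mono) auto
  have split: "(\<Sum>t=2..?t. of_bool (running p (t - 1)) * ((l - lam p (t - 1)) * gradient p t))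
      = (\<Sum>t=2..n. of_bool (running p (t - 1)) * ((l - lam p (t - 1)) * gradient p t))
        + of_bool (running p n) * ((l - lam p n) * gradient p ?t)"
    using t by simp
  have IH: "(\<Sum>t=2..n. of_bool (running p (t - 1)) * ((l - lam p (t - 1)) * gradient p t))
      \<le> sqrt (real n) * (?W n + 8 * vbar * err_const)"
    using Suc by simp
  have step: "of_bool (running p n) * ((l - lam p n) * gradient p ?t)
     \<le> sqrt (real ?t) * (?W ?t - ?W n) + (sqrt (real ?t) - sqrt (real n)) * (8 * vbar * err_const)"
  proof (cases "running p n")
    case False
    then show ?thesis using K by (simp add: state_Suc)
  next
    case True
    define s where "s = sqrt (real ?t)"
    define g where "g = gradient p ?t"
    define w where "w = vbar * s"
    define d where "d = (lam p n - l)\<^sup>2 - (lam p ?t - l)\<^sup>2"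
    have s: "0 < s" and w: "0 < w" using vbar by (auto simp: s_def w_def)
    have "lam p ?t = max 0 (lam p n + g / w)"
      using True Suc.hyps by (simp add: state_Suc s_def g_def w_def)
    \<comment> \<open>Projection onto the nonnegative half-line does not move the iterate away from
      \<open>l \<ge> 0\<close>.\<close>
    then have "(lam p ?t - l)\<^sup>2 \<le> (lam p n + g / w - l)\<^sup>2"
      using l by (auto simp: max_def abs_le_square_iff[symmetric])
    also have "\<dots> = (lam p n - l)\<^sup>2 - 2 * ((l - lam p n) * g) / w + g\<^sup>2 / w\<^sup>2"
      using w by (simp add: power2_eq_square field_simps)
    finally have "2 * ((l - lam p n) * g) / w \<le> d + g\<^sup>2 / w\<^sup>2" by (simp add: d_def)
    then have "(w / 2) * (2 * ((l - lam p n) * g) / w) \<le> (w / 2) * (d + g\<^sup>2 / w\<^sup>2)"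
      using w by (intro mult_left_mono) auto
    then have "(l - lam p n) * g \<le> w / 2 * d + g\<^sup>2 / (2 * w)"
      using w by (simp add: distrib_left power2_eq_square)
    also have "w / 2 * d = s * (?W ?t - ?W n)" by (simp add: w_def d_def algebra_simps)
    also have "g\<^sup>2 / (2 * w) = g\<^sup>2 / (2 * vbar) * (1 / s)" by (simp add: w_def)
    also have "g\<^sup>2 / (2 * vbar) * (1 / s) \<le> (8 * vbar\<^sup>2 * err_const) / (2 * vbar) * (1 / s)"
      using gradient_sq_le[OF t] s vbar by (intro mult_right_mono divide_right_mono) (auto simp: g_def)
    also have "\<dots> = (4 * vbar * err_const) * (1 / s)"
      using vbar by (simp add: power2_eq_square)
    also have "\<dots> \<le> (4 * vbar * err_const) * (2 * (s - sqrt (real n)))"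
      using inverse_sqrt_le[of n] K by (intro mult_left_mono) (auto simp: s_def)
    finally show ?thesis using True by (simp add: s_def g_def algebra_simps)
  qed
  show ?case
    using split IH step W by (simp add: algebra_simps)
qed

text \<open>Because \<open>rho / vbar * ctil \<le> rho\<close>, buying is compared with the fractional purchase
  \<open>rho / vbar\<close>, which never overspends.\<close>

lemma round_reward:
  assumes t: "t \<in> {2..T}"
  shows "play t p * r \<ge> of_bool (running p (t - 1)) * (rho / vbar * r + lam p (t - 1) * gradient p t)
    - 2 * \<bar>rtil T p t (v t) - r\<bar>"
proof (cases "running p (t - 1)")
  case False
  then show ?thesis by (simp add: play_def)
next
  case True
  have t1: "t \<in> {1..T}" using t by auto
  let ?R = "rtil T p t (v t)" and ?C = "ctil T p t (v t)" and ?l = "lam p (t - 1)" and ?a = "rho / vbar"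
  let ?x = "play t p"
  have a: "0 \<le> ?a" "?a \<le> 1" using vbar rho by auto
  have x: "?x = (if ?R \<ge> ?l * ?C then 1 else 0)"
    using True t by (simp add: play_def ogd_x_def)
  have "?a * (?R - ?l * ?C) \<le> ?x * (?R - ?l * ?C)"
  proof (cases "?R \<ge> ?l * ?C")
    case True
    then show ?thesis using x a mult_right_mono[of ?a 1 "?R - ?l * ?C"] by simp
  next
    case False
    then show ?thesis using x a mult_nonneg_nonpos[of ?a "?R - ?l * ?C"] by simp
  qed
  moreover have "?a * (?l * ?C) \<le> ?l * rho"
  proof -
    have "?a * ?C \<le> ?a * vbar" using a ctil_le[OF t1] by (intro mult_left_mono) auto
    then have "?l * (?a * ?C) \<le> ?l * rho" using lam_nonneg vbar by (intro mult_left_mono) auto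
    then show ?thesis by (simp add: mult_ac)
  qed
  ultimately have 1: "?a * ?R + ?l * gradient p t \<le> ?x * ?R"
    by (simp add: gradient_def algebra_simps)
  \<comment> \<open>The estimate is exchanged for \<open>r\<close> once on each side of the
    inequality, hence the factor 2 in the error.\<close>
  have "?x * (?R - r) \<le> \<bar>?R - r\<bar>" "?a * (r - ?R) \<le> \<bar>r - ?R\<bar>"
    using play_bounds[of t p] a by (intro mult_le_abs; simp)+
  moreover have "\<bar>r - ?R\<bar> = \<bar>?R - r\<bar>" by (rule abs_minus_commute)
  ultimately show ?thesis using 1 True unfolding right_diff_distrib of_bool_eq mult_1 by simp
qed

text \<open>Purely deterministic: \<open>r\<close> and \<open>c\<close> are arbitrary sequences in
  \<open>[0, vbar]\<close>, to be instantiated later by expected rewards and costs. The term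
  \<open>3 * vbar\<close> pays for the reward of round 1, the cost of round 1 and the budget left at
  the stop.\<close>

lemma revenue_lower_bound:
  fixes r c :: "nat \<Rightarrow> real"
  assumes T: "1 \<le> T"
    and r: "\<And>t. 0 \<le> r t \<and> r t \<le> vbar" and c: "\<And>t. 0 \<le> c t \<and> c t \<le> vbar"
  shows "ogd_revenue vbar rho T v p - rho / vbar * hindsight rho T v p \<ge>
    - (\<bar>\<Sum>t=1..T. play t p * (rew (v t) (p t) - r t)\<bar> + \<bar>\<Sum>t=1..T. play t p * (cst (v t) (p t) - c t)\<bar>
       + \<bar>\<Sum>t=1..T. rew (v t) (p t) - r t\<bar>
       + (\<Sum>t=2..T. 2 * \<bar>rtil T p t (v t) - r t\<bar> + \<bar>ctil T p t (v t) - c t\<bar>)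
       + 3 * vbar + sqrt (real T) * (vbar / 2 * lam_max\<^sup>2 + 8 * vbar * err_const))"
proof -
  define A where "A t = (of_bool (running p (t - 1)) :: real)" for t
  define a where "a = rho / vbar"
  define Mr where "Mr = (\<Sum>t=1..T. play t p * (rew (v t) (p t) - r t))"
  define Mc where "Mc = (\<Sum>t=1..T. play t p * (cst (v t) (p t) - c t))"
  define Nr where "Nr = (\<Sum>t=1..T. rew (v t) (p t) - r t)"
  define Er where "Er = (\<Sum>t=2..T. \<bar>rtil T p t (v t) - r t\<bar>)"
  define Ec where "Ec = (\<Sum>t=2..T. \<bar>ctil T p t (v t) - c t\<bar>)"
  define Reg where "Reg = sqrt (real T) * (vbar / 2 * lam_max\<^sup>2 + 8 * vbar * err_const)"
  have a: "0 \<le> a" "a \<le> 1" "a * vbar = rho" using vbar rho by (auto simp: a_def)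
  have A: "0 \<le> A t" "A t \<le> 1" for t by (auto simp: A_def)
  have split1: "(\<Sum>t=1..T. f t) = f 1 + (\<Sum>t=2..T. f t)" for f :: "nat \<Rightarrow> real"
    using T by (simp add: sum.atLeast_Suc_atMost numeral_2_eq_2)
  have Ec_nn: "0 \<le> Ec" by (auto simp: Ec_def intro: sum_nonneg)
  have Reg_nn: "0 \<le> Reg" using vbar ln_nat_nonneg[of T] by (simp add: Reg_def err_const_def)
  have regret: "(\<Sum>t=2..T. A t * (lam p (t - 1) * gradient p t))
      \<ge> l * (\<Sum>t=2..T. A t * gradient p t) - Reg" if "0 \<le> l" "l \<le> 1" for l
  proof -
    have "(\<Sum>t=2..T. A t * ((l - lam p (t - 1)) * gradient p t))
        \<le> sqrt (real T) * (vbar / 2 * (lam_max\<^sup>2 - (lam p T - l)\<^sup>2) + 8 * vbar * err_const)"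
      unfolding A_def using T by (intro ogd_regret that) auto
    also have "\<dots> \<le> Reg" unfolding Reg_def using vbar by (intro mult_left_mono) auto
    finally show ?thesis
      by (simp add: sum_subtractf sum_distrib_left algebra_simps)
  qed
  \<comment> \<open>The comparator \<open>l\<close> is 0 if the algorithm is still running after
    round \<open>T\<close> and 1 if it stopped. It may depend on the path because
    \<open>ogd_regret\<close> holds for every \<open>l\<close> in \<open>[0, 1]\<close>.\<close>
  have key: "(\<Sum>t=2..T. A t * (a * r t)) + l * (\<Sum>t=2..T. A t * gradient p t)
      \<ge> a * (\<Sum>t=1..T. r t) - \<bar>Mc\<bar> - Ec - 3 * vbar" if "l = of_bool (\<not> running p T)" for l
  proof -
    have ar1: "a * r 1 \<le> vbar" using a r[of 1] vbar mult_mono[of a 1 "r 1" vbar] by simp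
    show ?thesis
    proof (cases "running p T")
      case True
      then have "A t = 1" if "t \<in> {2..T}" for t
        using that True by (auto simp: A_def intro: running_antimono[of _ T])
      then have "(\<Sum>t=2..T. A t * (a * r t)) = a * (\<Sum>t=2..T. r t)"
        by (simp add: sum_distrib_left)
      then show ?thesis using True that ar1 Ec_nn vbar split1[of r]
        by (simp add: algebra_simps)
    next
      case False
      have cnn: "0 \<le> cst (v t) (p t)" if "t \<in> {1..T}" for t
        using cst_bounds[of "v t" "p t"] v_range[OF that] p_range[OF that] by simp
      have spent: "rho * real T - vbar < (\<Sum>t=1..T. play t p * cst (v t) (p t))"
        using not_running_budget[OF False] cnn by (simp add: budget_eq)
      have "(\<Sum>t=1..T. play t p * cst (v t) (p t)) = Mc + (\<Sum>t=1..T. play t p * c t)"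
        by (simp add: Mc_def sum_subtractf algebra_simps)
      moreover have "play 1 p * c 1 \<le> vbar"
        using play_bounds[of 1 p] c[of 1] vbar mult_mono[of "play 1 p" 1 "c 1" vbar] by simp
      moreover have "(\<Sum>t=2..T. play t p * c t) \<le> (\<Sum>t=2..T. play t p * ctil T p t (v t)) + Ec"
        unfolding Ec_def sum.distrib[symmetric]
      proof (rule sum_mono)
        fix t
        show "play t p * c t \<le> play t p * ctil T p t (v t) + \<bar>ctil T p t (v t) - c t\<bar>"
          using abs_ge_self[of "c t - ctil T p t (v t)"]
            play_cases[of t p] by (elim disjE) (simp_all add: abs_minus_commute)
      qed
      ultimately have "rho * real T - 2 * vbar - \<bar>Mc\<bar> - Ec \<le> (\<Sum>t=2..T. play t p * ctil T p t (v t))"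
        using spent split1[of "\<lambda>t. play t p * c t"] by linarith
      moreover have "(\<Sum>t=2..T. A t * gradient p t)
          = (\<Sum>t=2..T. play t p * ctil T p t (v t)) - rho * (\<Sum>t=2..T. A t)"
        unfolding sum_distrib_left sum_subtractf[symmetric]
        by (rule sum.cong) (auto simp: gradient_def A_def play_def)
      \<comment> \<open>Each round missed after the stop is worth at most
        \<open>a * vbar = rho\<close> to the benchmark, exactly the \<open>rho\<close> that its
        absence leaves in the gradient sum.\<close>
      moreover have "(\<Sum>t=2..T. a * r t - A t * (a * r t)) \<le> (\<Sum>t=2..T. rho * (1 - A t))"
      proof (rule sum_mono)
        fix t
        have "a * r t \<le> rho" using a r[of t] mult_left_mono[of "r t" vbar a] by simp
        then have "(a * r t) * (1 - A t) \<le> rho * (1 - A t)" using A[of t] by (intro mult_right_mono) auto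
        then show "a * r t - A t * (a * r t) \<le> rho * (1 - A t)" by (simp add: algebra_simps)
      qed
      moreover have "(\<Sum>t=2..T. rho * (1 - A t)) \<le> rho * real T - rho * (\<Sum>t=2..T. A t)"
        using rho T by (simp add: sum_subtractf sum_distrib_left algebra_simps)
      moreover note sum_subtractf[of "\<lambda>t. a * r t" "\<lambda>t. A t * (a * r t)" "{2..T}"]
      ultimately have "(\<Sum>t=2..T. A t * (a * r t)) + (\<Sum>t=2..T. A t * gradient p t)
          \<ge> (\<Sum>t=2..T. a * r t) - 2 * vbar - \<bar>Mc\<bar> - Ec"
        by linarith
      then show ?thesis using False that ar1 split1[of r]
        by (simp add: sum_distrib_left algebra_simps)
    qed
  qed
  have "(\<Sum>t=2..T. A t * (a * r t + lam p (t - 1) * gradient p t) - 2 * \<bar>rtil T p t (v t) - r t\<bar>)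
      \<le> (\<Sum>t=2..T. play t p * r t)"
    unfolding A_def a_def by (intro sum_mono round_reward) auto
  then have "(\<Sum>t=2..T. A t * (a * r t)) + (\<Sum>t=2..T. A t * (lam p (t - 1) * gradient p t)) - 2 * Er
      \<le> (\<Sum>t=2..T. play t p * r t)"
    by (simp add: Er_def sum_subtractf sum.distrib sum_distrib_left distrib_left)
  moreover have "0 \<le> play 1 p * r 1" using play_bounds r by simp
  ultimately have "a * (\<Sum>t=1..T. r t) - \<bar>Mc\<bar> - Ec - 3 * vbar - Reg - 2 * Er \<le> (\<Sum>t=1..T. play t p * r t)"
    using key[OF refl] regret[of "of_bool (\<not> running p T)"] split1[of "\<lambda>t. play t p * r t"] by simp
  moreover have "ogd_revenue vbar rho T v p = Mr + (\<Sum>t=1..T. play t p * r t)"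
    by (simp add: ogd_revenue_eq Mr_def sum_subtractf algebra_simps)
  moreover have "a * hindsight rho T v p \<le> a * (\<Sum>t=1..T. r t) + \<bar>Nr\<bar>"
  proof -
    have "a * hindsight rho T v p \<le> a * (\<Sum>t=1..T. rew (v t) (p t))"
      using a rho by (intro mult_left_mono hindsight_le) auto
    also have "\<dots> = a * (\<Sum>t=1..T. r t) + a * Nr"
      by (simp add: Nr_def sum_subtractf algebra_simps)
    also have "a * Nr \<le> \<bar>Nr\<bar>" using a by (intro mult_le_abs)
    finally show ?thesis by simp
  qed
  moreover have "(\<Sum>t=2..T. 2 * \<bar>rtil T p t (v t) - r t\<bar> + \<bar>ctil T p t (v t) - c t\<bar>) = 2 * Er + Ec"
    by (simp add: Er_def Ec_def sum.distrib sum_distrib_left)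
  ultimately show ?thesis
    unfolding a_def[symmetric] Mr_def[symmetric] Mc_def[symmetric] Nr_def[symmetric] Reg_def[symmetric]
    by linarith
qed

end

section \<open>Expectation\<close>

lemma ogd_x_cong:
  assumes "\<And>s. s < t \<Longrightarrow> p s = q s"
  shows "ctil T p t x = ctil T q t x" "ogd_x T v p t l = ogd_x T v q t l"
proof -
  have "(\<Sum>s\<in>{1..<t}. rew y (p s)) = (\<Sum>s\<in>{1..<t}. rew y (q s))"
    and "(\<Sum>s\<in>{1..<t}. cst y (p s)) = (\<Sum>s\<in>{1..<t}. cst y (q s))" for y
    using assms by (auto intro!: sum.cong)
  then show "ctil T p t x = ctil T q t x" "ogd_x T v p t l = ogd_x T v q t l"
    by (simp_all add: ogd_x_def rtil_eq ctil_eq)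
qed

lemma ogd_state_cong:
  "(\<And>s. s \<le> n \<Longrightarrow> p s = q s) \<Longrightarrow> ogd_state vbar rho T v p n = ogd_state vbar rho T v q n"
proof (induction n)
  case (Suc n)
  have "ogd_state vbar rho T v p n = ogd_state vbar rho T v q n" using Suc by simp
  moreover have "ctil T p (Suc n) x = ctil T q (Suc n) x" "ogd_x T v p (Suc n) l = ogd_x T v q (Suc n) l" for x l
    using Suc.prems by (auto intro!: ogd_x_cong)
  moreover obtain l B run R where "ogd_state vbar rho T v q n = (l, B, run, R)"
    by (metis prod_cases4)
  ultimately show ?case using Suc.prems[of "Suc n"] by (simp add: Let_def)
qed simp

text \<open>Supplies the predictability hypothesis \<open>y_past\<close> of the martingale
  bound.\<close>

lemma play_past:
  assumes "t \<le> s" shows "play t (p(s := u)) = play t p"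
proof (cases "t = 0")
  \<comment> \<open>Truncated subtraction gives \<open>t - 1 = 0\<close>, and for
    \<open>s = 0\<close> the two paths may differ at index 0, so the congruence lemma does not
    apply; the estimates are over empty ranges here.\<close>
  case True
  then show ?thesis by (simp add: play_def ogd_x_def rtil_def ctil_def)
next
  case False
  then have "ogd_state vbar rho T v (p(s := u)) (t - 1) = ogd_state vbar rho T v p (t - 1)"
    using assms by (intro ogd_state_cong) auto
  moreover have "ogd_x T v (p(s := u)) t l = ogd_x T v p t l" for l
    using assms by (intro ogd_x_cong) auto
  ultimately show ?thesis by (simp add: play_def lam_def running_def)
qed

section \<open>Measurability of the state and of the decisions\<close>

context
  fixes G :: "real measure"
  assumes sets_G [measurable_cong]: "sets G = sets borel"
begin

lemma component_measurable:
  "s \<in> {1..T} \<Longrightarrow> (\<lambda>p. p s) \<in> borel_measurable (PiM {1..T} (\<lambda>_. G))"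
  using measurable_component_singleton[of s "{1..T}" "\<lambda>_. G"]
  by (simp add: measurable_cong_sets[OF refl sets_G])

lemma rew_measurable: "rew x \<in> borel_measurable borel"
  unfolding rew_def[abs_def] by measurable

lemma cst_measurable: "cst x \<in> borel_measurable borel"
  unfolding cst_def[abs_def] by measurable

lemma estimates_measurable:
  assumes "t \<in> {1..T}"
  shows "(\<lambda>p. rtil T p t x) \<in> borel_measurable (PiM {1..T} (\<lambda>_. G))"
    and "(\<lambda>p. ctil T p t x) \<in> borel_measurable (PiM {1..T} (\<lambda>_. G))"
proof -
  have "(\<lambda>p. p s) \<in> borel_measurable (PiM {1..T} (\<lambda>_. G))" if "s \<in> {1..<t}" for s
    using that assms by (intro component_measurable) auto
  note comp = this
  show "(\<lambda>p. rtil T p t x) \<in> borel_measurable (PiM {1..T} (\<lambda>_. G))"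
    unfolding rtil_eq
    by (intro borel_measurable_add borel_measurable_times borel_measurable_const borel_measurable_sum
        measurable_compose[OF comp rew_measurable])
  show "(\<lambda>p. ctil T p t x) \<in> borel_measurable (PiM {1..T} (\<lambda>_. G))"
    unfolding ctil_eq
    by (intro borel_measurable_diff borel_measurable_times borel_measurable_const borel_measurable_sum
        measurable_compose[OF comp cst_measurable])
qed

text \<open>Measurability of the previous state is an assumption so that the lemma can serve inside
  the induction that proves it.\<close>

lemma play_measurable_step:
  assumes t: "t \<in> {1..T}"
    and [measurable]: "(\<lambda>p. lam p (t - 1)) \<in> borel_measurable (PiM {1..T} (\<lambda>_. G))"
      "Measurable.pred (PiM {1..T} (\<lambda>_. G)) (\<lambda>p. running p (t - 1))"
  shows "play t \<in> borel_measurable (PiM {1..T} (\<lambda>_. G))"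
proof -
  note [measurable] = estimates_measurable[OF t]
  show ?thesis unfolding play_def[abs_def] ogd_x_def by measurable
qed

text \<open>The three components need a joint induction: the stopping flag reads the budget, the
  budget reads the decision, and the decision reads the multiplier and the flag.\<close>

lemma state_measurable:
  "n \<le> T \<Longrightarrow> (\<lambda>p. lam p n) \<in> borel_measurable (PiM {1..T} (\<lambda>_. G))
    \<and> (\<lambda>p. budget p n) \<in> borel_measurable (PiM {1..T} (\<lambda>_. G))
    \<and> Measurable.pred (PiM {1..T} (\<lambda>_. G)) (\<lambda>p. running p n)"
proof (induction n)
  case (Suc n)
  have t: "Suc n \<in> {1..T}" using Suc by auto
  note IH = Suc.IH[OF Suc_leD[OF Suc.prems]]
  note [measurable] = conjunct1[OF IH] conjunct1[OF conjunct2[OF IH]] conjunct2[OF conjunct2[OF IH]]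
  have [measurable]: "play (Suc n) \<in> borel_measurable (PiM {1..T} (\<lambda>_. G))"
    using IH by (intro play_measurable_step t) simp_all
  note [measurable] = estimates_measurable[OF t] measurable_compose[OF component_measurable[OF t] cst_measurable]
  show ?case unfolding state_Suc gradient_def by (intro conjI; measurable)
qed simp

lemma play_measurable: "t \<in> {1..T} \<Longrightarrow> play t \<in> borel_measurable (PiM {1..T} (\<lambda>_. G))"
  using state_measurable[of "t - 1"] by (intro play_measurable_step) auto

end

text \<open>The 9 is 3 for the sums \<open>F1\<close>, \<open>F2\<close>, \<open>F3\<close> below
  plus 2 * 3 for the estimation errors, and the 8 is 2 * 4 for the confidence widths; the 2 comes
  from \<open>sum_inverse_sqrt_le\<close>.\<close>

definition regret_bound :: real where
  "regret_bound = (9 + 8 * sqrt (ln 2 + 2 * ln (real T))) * vbar * sqrt (real T)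
    + 3 * vbar + sqrt (real T) * (vbar / 2 * lam_max\<^sup>2 + 8 * vbar * err_const)"

text \<open>If the integrand is not integrable, its integral is \<open>0\<close> by convention, so a pathwise
  integrable minorant suffices.\<close>

lemma expected_revenue_lower_bound:
  assumes T: "1 \<le> T" and G: "G \<in> bid_dists vbar"
  shows "(\<integral>p. (ogd_revenue vbar rho T v p - rho / vbar * hindsight rho T v p)
      \<partial>(PiM {1..T} (\<lambda>_. G))) \<ge> - regret_bound"
proof -
  have sets_G: "sets G = sets borel" and prob: "prob_space G" and supp: "measure G {0..vbar} = 1"
    using G by (auto simp: bid_dists_def)
  interpret G: prob_space G by (rule prob)
  define M where "M = PiM {1..T} (\<lambda>_. G)"
  interpret M: prob_space M unfolding M_def by (rule prob_space_PiM) (rule prob)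
  \<comment> \<open>Clipping the price at 0 and vanishing outside \<open>1..T\<close> make the
    bounds hold for all arguments, as the martingale lemma demands; on the support of
    \<open>G\<close> nothing changes.\<close>
  define hr where "hr t u = (if t \<in> {1..T} then rew (v t) (max 0 u) else 0)" for t u
  define hc where "hc t u = (if t \<in> {1..T} then cst (v t) (max 0 u) else 0)" for t u
  define r where "r t = (\<integral>u. hr t u \<partial>G)" for t
  define c where "c t = (\<integral>u. hc t u \<partial>G)" for t
  have h_bound: "0 \<le> hr t u \<and> hr t u \<le> vbar" "0 \<le> hc t u \<and> hc t u \<le> vbar" for t u
    using rew_bounds[of "v t" "max 0 u"] cst_bounds[of "v t" "max 0 u"] v_range[of t] vbar
    by (auto simp: hr_def hc_def)
  have max0: "(\<lambda>u::real. max 0 u) \<in> borel_measurable borel" by measurable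
  have h_meas: "hr t \<in> borel_measurable G" "hc t \<in> borel_measurable G" for t
    using measurable_compose[OF max0 rew_measurable] measurable_compose[OF max0 cst_measurable]
    by (auto simp: hr_def[abs_def] hc_def[abs_def] measurable_cong_sets[OF sets_G refl])
  have r_bound: "0 \<le> r t \<and> r t \<le> vbar" and c_bound: "0 \<le> c t \<and> c t \<le> vbar" for t
  proof -
    have "integrable G (hr t)" "integrable G (hc t)"
      using h_bound[of t] h_meas[of t] by (auto intro!: G.integrable_const_bound[where B=vbar])
    then show "0 \<le> r t \<and> r t \<le> vbar" "0 \<le> c t \<and> c t \<le> vbar"
      using h_bound[of t] unfolding r_def c_def
      by (auto intro!: integral_nonneg G.integral_le_const)
  qed
  define F1 where "F1 p = \<bar>\<Sum>t=1..T. play t p * (hr t (p t) - r t)\<bar>" for p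
  define F2 where "F2 p = \<bar>\<Sum>t=1..T. play t p * (hc t (p t) - c t)\<bar>" for p
  define F3 where "F3 p = \<bar>\<Sum>t=1..T. 1 * (hr t (p t) - r t)\<bar>" for p
  \<comment> \<open>Here the single function \<open>hr t\<close> is evaluated at all past prices;
    this is a sum of centred i.i.d. terms because \<open>v t\<close> is fixed in advance. The factor
    \<open>1 *\<close> is the constant weight in \<open>conc\<close>.\<close>
  define Er where "Er t p = \<bar>\<Sum>s=1..t-1. 1 * (hr t (p s) - r t)\<bar>" for t p
  define Ec where "Ec t p = \<bar>\<Sum>s=1..t-1. 1 * (hc t (p s) - c t)\<bar>" for t p
  define D where "D = 3 * vbar + sqrt (real T) * (vbar / 2 * lam_max\<^sup>2 + 8 * vbar * err_const)"
  \<comment> \<open>The confidence width enters \<open>rtil\<close> once and \<open>ctil\<close>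
    twice; with weights 2 and 1 this gives 4.\<close>
  define e where "e t p = (2 * Er t p + Ec t p) / real (t - 1) + 4 * eps_t T t * vbar" for t p
  define H where "H p = F1 p + F2 p + F3 p + (\<Sum>t=2..T. e t p) + D" for p
  have play_abs: "\<bar>play t p\<bar> \<le> 1" for t p using play_bounds[of t p] by simp
  have play_meas: "play t \<in> borel_measurable M" if "t \<in> {1..T}" for t
    unfolding M_def by (rule play_measurable[OF sets_G that])
  have conc: "integrable M (\<lambda>p. \<bar>\<Sum>t=1..n. y t p * (h t (p t) - (\<integral>u. h t u \<partial>G))\<bar>)"
    "(\<integral>p. \<bar>\<Sum>t=1..n. y t p * (h t (p t) - (\<integral>u. h t u \<partial>G))\<bar> \<partial>M) \<le> vbar * sqrt (real n)"
    if n: "n \<le> T" and y: "\<And>t. t \<in> {1..T} \<Longrightarrow> y t \<in> borel_measurable M"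
      "\<And>t p. \<bar>y t p\<bar> \<le> 1" "\<And>t s p u. t \<le> s \<Longrightarrow> y t (p(s := u)) = y t p"
      and h: "\<And>t. h t \<in> borel_measurable G" "\<And>t u. 0 \<le> h t u \<and> h t u \<le> vbar" for n y h
  proof -
    have sub: "{1..n} \<subseteq> {1..T}" using n by auto
    have ym: "y t \<in> borel_measurable (PiM {1..T} (\<lambda>_. G))" if "t \<in> {1..n}" for t
      using y(1)[of t] that sub unfolding M_def by blast
    show "integrable M (\<lambda>p. \<bar>\<Sum>t=1..n. y t p * (h t (p t) - (\<integral>u. h t u \<partial>G))\<bar>)"
      "(\<integral>p. \<bar>\<Sum>t=1..n. y t p * (h t (p t) - (\<integral>u. h t u \<partial>G))\<bar> \<partial>M) \<le> vbar * sqrt (real n)"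
      unfolding M_def
      by (rule abs_sum_predictable_expectation[OF prob finite_atLeastAtMost sub vbar ym y(2,3) h];
          assumption)+
  qed
  have F1: "integrable M F1" "(\<integral>p. F1 p \<partial>M) \<le> vbar * sqrt (real T)"
    unfolding F1_def[abs_def] r_def
    by (rule conc[OF order_refl play_meas play_abs play_past h_meas(1) h_bound(1)]; assumption)+
  have F2: "integrable M F2" "(\<integral>p. F2 p \<partial>M) \<le> vbar * sqrt (real T)"
    unfolding F2_def[abs_def] c_def
    by (rule conc[OF order_refl play_meas play_abs play_past h_meas(2) h_bound(2)]; assumption)+
  have one: "(\<lambda>_. 1 :: real) \<in> borel_measurable M" "\<bar>1 :: real\<bar> \<le> 1" by simp_all
  note conc1 = conc[of _ "\<lambda>_ _. 1", OF _ one refl]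
  have F3: "integrable M F3" "(\<integral>p. F3 p \<partial>M) \<le> vbar * sqrt (real T)"
    unfolding F3_def[abs_def] r_def by (rule conc1[OF order_refl h_meas(1) h_bound(1)])+
  have Er: "integrable M (Er t)" "(\<integral>p. Er t p \<partial>M) \<le> vbar * sqrt (real (t - 1))"
    and Ec: "integrable M (Ec t)" "(\<integral>p. Ec t p \<partial>M) \<le> vbar * sqrt (real (t - 1))"
    if "t \<in> {2..T}" for t
  proof -
    have t: "t - 1 \<le> T" using that by auto
    show "integrable M (Er t)" "(\<integral>p. Er t p \<partial>M) \<le> vbar * sqrt (real (t - 1))"
      unfolding Er_def[abs_def] r_def by (rule conc1[of "t - 1" "\<lambda>_. hr t", OF t h_meas(1) h_bound(1)])+
    show "integrable M (Ec t)" "(\<integral>p. Ec t p \<partial>M) \<le> vbar * sqrt (real (t - 1))"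
      unfolding Ec_def[abs_def] c_def by (rule conc1[of "t - 1" "\<lambda>_. hc t", OF t h_meas(2) h_bound(2)])+
  qed
  define q where "q = sqrt (ln 2 + 2 * ln (real T))"
  have e: "integrable M (e t)" "(\<integral>p. e t p \<partial>M) \<le> (3 + 4 * q) * vbar * (1 / sqrt (real (t - 1)))"
    if t: "t \<in> {2..T}" for t
  proof -
    show "integrable M (e t)" unfolding e_def[abs_def] using Er[OF t] Ec[OF t] by auto
    have "(\<integral>p. e t p \<partial>M)
        = (2 * (\<integral>p. Er t p \<partial>M) + (\<integral>p. Ec t p \<partial>M)) / real (t - 1) + 4 * eps_t T t * vbar"
      unfolding e_def using Er(1)[OF t] Ec(1)[OF t] by (simp add: M.prob_space)
    also have "\<dots> \<le> (3 * (vbar * sqrt (real (t - 1)))) / real (t - 1)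
        + 4 * (q * (1 / sqrt (real (t - 1)))) * vbar"
      using Er(2)[OF t] Ec(2)[OF t] t vbar eps_t_le[of t T] unfolding q_def
      by (intro add_mono divide_right_mono mult_right_mono mult_left_mono) auto
    also have "sqrt (real (t - 1)) / real (t - 1) = 1 / sqrt (real (t - 1))"
      using t by (simp add: real_divide_square_eq field_simps)
    then have "(3 * (vbar * sqrt (real (t - 1)))) / real (t - 1) = 3 * vbar * (1 / sqrt (real (t - 1)))"
      by (metis (no_types, lifting) mult.assoc times_divide_eq_right)
    finally show "(\<integral>p. e t p \<partial>M) \<le> (3 + 4 * q) * vbar * (1 / sqrt (real (t - 1)))"
      by (simp add: algebra_simps)
  qed
  have H_int: "integrable M H"
    unfolding H_def[abs_def] using F1 F2 F3 e by (intro Bochner_Integration.integrable_add) auto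
  have "(\<integral>p. H p \<partial>M) = (\<integral>p. F1 p \<partial>M) + (\<integral>p. F2 p \<partial>M) + (\<integral>p. F3 p \<partial>M)
      + (\<Sum>t=2..T. \<integral>p. e t p \<partial>M) + D"
  proof -
    define g where "g p = (\<Sum>t=2..T. e t p)" for p
    have "integrable M g"
      unfolding g_def[abs_def] by (intro Bochner_Integration.integrable_sum e)
    moreover have "(\<integral>p. g p \<partial>M) = (\<Sum>t=2..T. \<integral>p. e t p \<partial>M)"
      unfolding g_def by (intro Bochner_Integration.integral_sum e)
    ultimately show ?thesis
      unfolding H_def g_def[symmetric] using F1(1) F2(1) F3(1) by (simp add: M.prob_space)
  qed
  also have "(\<Sum>t=2..T. \<integral>p. e t p \<partial>M) \<le> (\<Sum>t=2..T. (3 + 4 * q) * vbar * (1 / sqrt (real (t - 1))))"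
    by (intro sum_mono e)
  also have "\<dots> = (3 + 4 * q) * vbar * (\<Sum>t=2..T. 1 / sqrt (real (t - 1)))"
    by (simp add: sum_distrib_left)
  also have "\<dots> \<le> (3 + 4 * q) * vbar * (2 * sqrt (real T))"
    using vbar ln_nat_nonneg[of T] by (intro mult_left_mono sum_inverse_sqrt_le) (auto simp: q_def)
  finally have H_E: "(\<integral>p. H p \<partial>M) \<le> regret_bound"
    using F1 F2 F3 by (simp add: regret_bound_def D_def q_def algebra_simps)
  have "AE u in G. u \<in> {0..vbar}"
    using supp sets_G by (subst G.AE_in_set_eq_1) auto
  then have "AE p in M. p t \<in> {0..vbar}" if "t \<in> {1..T}" for t
    unfolding M_def using that prob by (intro AE_PiM_component) auto
  then have AE: "AE p in M. \<forall>t\<in>{1..T}. p t \<in> {0..vbar}"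
    by (intro AE_finite_allI) auto
  have bound: "- H p \<le> ogd_revenue vbar rho T v p - rho / vbar * hindsight rho T v p"
    if p: "\<forall>t\<in>{1..T}. p t \<in> {0..vbar}" for p
  proof -
    have pos: "0 \<le> p t" if "t \<in> {1..T}" for t using p that by auto
    have h_eq: "rew (v t) (p s) = hr t (p s)" "cst (v t) (p s) = hc t (p s)"
      if "t \<in> {1..T}" "s \<in> {1..T}" for t s
      using that pos[of s] by (auto simp: hr_def hc_def)
    have "2 * \<bar>rtil T p t (v t) - r t\<bar> + \<bar>ctil T p t (v t) - c t\<bar> \<le> e t p" if t: "t \<in> {2..T}" for t
    proof -
      have set_eq: "{1..<t} = {1..t - 1}" using t by auto
      have sums: "(\<Sum>s\<in>{1..<t}. rew (v t) (p s)) = (\<Sum>s=1..t-1. hr t (p s))"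
        "(\<Sum>s\<in>{1..<t}. cst (v t) (p s)) = (\<Sum>s=1..t-1. hc t (p s))"
        by (rule sum.cong[OF set_eq]; use t h_eq in auto)+
      have eps: "0 \<le> eps_t T t * v t" "eps_t T t * v t \<le> eps_t T t * vbar"
        using eps_t_nonneg v_range[of t] t by (auto intro!: mult_left_mono)
      have deviation: "x = y + z \<Longrightarrow> \<bar>y\<bar> = w \<Longrightarrow> 0 \<le> z \<Longrightarrow> z \<le> b \<Longrightarrow> \<bar>x\<bar> \<le> w + b"
        "x = y - 2 * z \<Longrightarrow> \<bar>y\<bar> = w \<Longrightarrow> 0 \<le> z \<Longrightarrow> z \<le> b \<Longrightarrow> \<bar>x\<bar> \<le> w + 2 * b"
        for x y z w b :: real
        by linarith+
      have abs_r: "\<bar>(\<Sum>s=1..t-1. 1 * (hr t (p s) - r t)) / real (t - 1)\<bar> = Er t p / real (t - 1)"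
        and abs_c: "\<bar>(\<Sum>s=1..t-1. 1 * (hc t (p s) - c t)) / real (t - 1)\<bar> = Ec t p / real (t - 1)"
        by (simp_all add: Er_def Ec_def)
      have "rtil T p t (v t) - r t = (\<Sum>s=1..t-1. 1 * (hr t (p s) - r t)) / real (t - 1) + eps_t T t * v t"
        unfolding rtil_eq sums using t by (simp add: sum_subtractf diff_divide_distrib of_nat_diff)
      from this abs_r eps have 1: "\<bar>rtil T p t (v t) - r t\<bar> \<le> Er t p / real (t - 1) + eps_t T t * vbar"
        by (rule deviation)
      have "ctil T p t (v t) - c t = (\<Sum>s=1..t-1. 1 * (hc t (p s) - c t)) / real (t - 1) - 2 * (eps_t T t * v t)"
        unfolding ctil_eq sums using t by (simp add: sum_subtractf diff_divide_distrib of_nat_diff)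
      from this abs_c eps have 2: "\<bar>ctil T p t (v t) - c t\<bar> \<le> Ec t p / real (t - 1) + 2 * (eps_t T t * vbar)"
        by (rule deviation)
      show ?thesis using 1 2 by (simp add: e_def add_divide_distrib)
    qed
    then have "(\<Sum>t=2..T. 2 * \<bar>rtil T p t (v t) - r t\<bar> + \<bar>ctil T p t (v t) - c t\<bar>) \<le> (\<Sum>t=2..T. e t p)"
      by (rule sum_mono)
    moreover have "\<bar>\<Sum>t=1..T. play t p * (rew (v t) (p t) - r t)\<bar> = F1 p"
      "\<bar>\<Sum>t=1..T. play t p * (cst (v t) (p t) - c t)\<bar> = F2 p"
      "\<bar>\<Sum>t=1..T. rew (v t) (p t) - r t\<bar> = F3 p"
      unfolding F1_def F2_def F3_def by (auto intro!: arg_cong[of _ _ abs] sum.cong simp: h_eq)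
    ultimately show ?thesis
      using revenue_lower_bound[of p r c, OF pos T r_bound c_bound] unfolding H_def D_def by linarith
  qed
  let ?f = "\<lambda>p. ogd_revenue vbar rho T v p - rho / vbar * hindsight rho T v p"
  have "- regret_bound \<le> (\<integral>p. ?f p \<partial>M)"
  proof (cases "integrable M ?f")
    case True
    have "(\<integral>p. - H p \<partial>M) \<le> (\<integral>p. ?f p \<partial>M)"
    proof (rule integral_mono_AE)
      show "AE p in M. - H p \<le> ?f p" using AE by (rule eventually_mono) (rule bound)
    qed (use True H_int in auto)
    then show ?thesis using H_E H_int by simp
  next
    case False
    have "0 \<le> regret_bound"
      using vbar ln_nat_nonneg[of T] by (auto simp: regret_bound_def err_const_def)
    then show ?thesis unfolding not_integrable_integral_eq[OF False] by simp
  qed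
  then show ?thesis unfolding M_def .
qed

end

section \<open>Passage to the limit\<close>

theorem theorem5:
  fixes vbar rho :: real
  assumes "0 < vbar" and "0 < rho" and "rho \<le> vbar"
  shows "0 \<le> liminf (\<lambda>T::nat.
            INF v \<in> value_seqs vbar T. INF G \<in> bid_dists vbar.
              ereal ((1 / real T) *
                (\<integral>p. (ogd_revenue vbar rho T v p - rho / vbar * hindsight rho T v p)
                   \<partial>(PiM {1..T} (\<lambda>_. G)))))"
proof -
  define C where "C = vbar / 2 * (3 * vbar / (2 * rho) + 1)\<^sup>2"
  \<comment> \<open>\<open>regret_bound\<close> unfolded as an explicit function of
    \<open>T\<close>. It has order \<open>sqrt T * ln T\<close>, so its quotient by \<open>T\<close>
    vanishes.\<close>
  define b where "b T = (9 + 8 * sqrt (ln 2 + 2 * ln (real T))) * vbar * sqrt (real T)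
    + 3 * vbar + sqrt (real T) * (C + 8 * vbar * (1 + ln 2 + 2 * ln (real T)))" for T :: nat
  have "(\<lambda>T. - b T / real T) \<longlonglongrightarrow> 0"
    unfolding b_def using assms(1) by real_asymp
  then have "(\<lambda>T. ereal (- b T / real T)) \<longlonglongrightarrow> ereal 0" by simp
  then have "liminf (\<lambda>T. ereal (- b T / real T)) = ereal 0"
    by (intro lim_imp_Liminf) auto
  then have "0 = liminf (\<lambda>T. ereal (- b T / real T))" by (simp only: zero_ereal_def)
  also have "\<dots> \<le> liminf (\<lambda>T::nat. INF v \<in> value_seqs vbar T. INF G \<in> bid_dists vbar.
              ereal ((1 / real T) *
                (\<integral>p. (ogd_revenue vbar rho T v p - rho / vbar * hindsight rho T v p)
                   \<partial>(PiM {1..T} (\<lambda>_. G)))))"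
  \<comment> \<open>The bound \<open>b T\<close> depends on neither \<open>v\<close> nor
    \<open>G\<close>, so it passes through both infima.\<close>
  proof (intro Liminf_mono eventually_mono[OF eventually_ge_at_top[of 1]] INF_greatest)
    fix T :: nat and v G
    assume T: "1 \<le> T" and v: "v \<in> value_seqs vbar T" and G: "G \<in> bid_dists vbar"
    interpret ogd_cb vbar rho T v
      using assms v by unfold_locales (auto simp: value_seqs_def)
    have "regret_bound = b T"
      by (simp add: regret_bound_def b_def C_def lam_max_def err_const_def)
    then have "(1 / real T) * (- b T) \<le> (1 / real T) *
        (\<integral>p. (ogd_revenue vbar rho T v p - rho / vbar * hindsight rho T v p) \<partial>(PiM {1..T} (\<lambda>_. G)))"
      using expected_revenue_lower_bound[OF T G] by (intro mult_left_mono) auto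
    then show "ereal (- b T / real T) \<le> ereal ((1 / real T) *
        (\<integral>p. (ogd_revenue vbar rho T v p - rho / vbar * hindsight rho T v p) \<partial>(PiM {1..T} (\<lambda>_. G))))"
      by simp
  qed
  finally show ?thesis .
qed

end
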